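(* Let $R$ be a finite ring and let $\{r_1, r_2, \dots, r_t\}$ be a set of pairwise non-commuting elements of $R$ having maximal size. Then (a) $|\mathrm{Cent}(R)| = 4$ if and only if $t = 3$; (b) $|\mathrm{Cent}(R)| = 5$ if and only if $t = 4$.
   Context: Rings are associative; no identity element is assumed. For $x \in R$, the centralizer of $x$ is $C_R(x) = \{y \in R : xy = yx\}$, and $\mathrm{Cent}(R) = \{C_R(x) : x \in R\}$ is the set of all distinct centralizers of elements of $R$. A nonempty subset $\{r_1, \dots, r_t\}$ of $R$ (with $t$ distinct elements) is a set of pairwise non-commuting elements if $r_i r_j \neq r_j r_i$ for all $1 \le i \neq j \le t$; it has maximal size if its cardinality is the largest among all such subsets of $R$. *)

theory Defs
  imports Main
begin

text \<open>The type class \<^class>\<open>ring\<close> is that of associative rings, without an identity element.\<close>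

definition centralizer :: "'a::ring \<Rightarrow> 'a set" where
  "centralizer x = {y. x * y = y * x}"

definition Cent :: "'a::ring set set" where
  "Cent = range centralizer"

definition pairwise_noncommuting :: "'a::ring set \<Rightarrow> bool" where
  "pairwise_noncommuting S \<longleftrightarrow>
     finite S \<and> S \<noteq> {} \<and> pairwise (\<lambda>r s. r * s \<noteq> s * r) S"

definition max_pairwise_noncommuting :: "'a::ring set \<Rightarrow> bool" where
  "max_pairwise_noncommuting S \<longleftrightarrow>
     pairwise_noncommuting S \<and> (\<forall>T::'a set. pairwise_noncommuting T \<longrightarrow> card T \<le> card S)"

end

theory Submission
  imports Defs
begin

text \<open>
  Let \<open>S\<close> be a set of pairwise non-commuting elements of maximal size \<open>t \<ge> 2\<close>. No element of \<open>S\<close>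
  is central, and distinct elements of \<open>S\<close> have distinct centralizers, because \<open>r\<close> lies in its own
  centralizer and not in that of any other element of \<open>S\<close>. Together with the centralizer of \<open>0\<close>,
  which is the whole ring, this gives at least \<open>t + 1\<close> centralizers, for every \<open>t\<close>.

  There are no others as soon as every non-central element has a commutative centralizer: then two
  commuting non-central elements have the same centralizer, and by maximality every non-central
  element commutes with a member of \<open>S\<close>.

  A non-central \<open>x\<close> whose centralizer contains non-commuting \<open>y\<close> and \<open>z\<close> forces \<open>t \<ge> 5\<close>. Choose
  \<open>w\<close> that does not commute with \<open>x\<close>. The three elements \<open>y\<close>, \<open>z\<close>, \<open>y + z\<close> commute with \<open>x\<close> and
  pairwise fail to commute with each other, and these properties survive adding \<open>x\<close> to any of them.
  Such an addition changes the commutator with \<open>w\<close> by a nonzero amount, so each of the three can be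
  arranged not to commute with \<open>w\<close>, and then it does not commute with \<open>w + x\<close> either. The three
  elements so obtained, with \<open>w\<close> and \<open>w + x\<close>, are five pairwise non-commuting elements
  (lemma \<open>five_pairwise_noncommuting\<close>).

  Hence \<open>2 \<le> t \<le> 4\<close> implies that there are exactly \<open>t + 1\<close> centralizers. In the other direction,
  the lower bound turns 4 or 5 centralizers into \<open>t \<le> 3\<close> or \<open>t \<le> 4\<close>, so that the exact count
  applies again and determines \<open>t\<close>. The remaining case \<open>t = 1\<close> is that of a commutative ring, with a
  single centralizer.
\<close>

lemma mem_centralizer_commute: "y \<in> centralizer x \<longleftrightarrow> x \<in> centralizer y"
  by (auto simp: centralizer_def)

lemma self_mem_centralizer: "x \<in> centralizer x"
  by (simp add: centralizer_def)

lemma add_mem_centralizer_iff: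
  assumes "a \<in> centralizer x"
  shows "a + b \<in> centralizer x \<longleftrightarrow> b \<in> centralizer x"
    and "b + a \<in> centralizer x \<longleftrightarrow> b \<in> centralizer x"
  using assms by (auto simp: centralizer_def distrib_left distrib_right)

lemma centralizer_zero: "centralizer 0 = UNIV"
  by (simp add: centralizer_def)

lemma pairwise_noncommutingD:
  assumes "pairwise_noncommuting S" "r \<in> S" "s \<in> S" "s \<in> centralizer r"
  shows "r = s"
  using assms by (auto simp: pairwise_noncommuting_def pairwise_def centralizer_def)

lemma max_pairwise_noncommutingD:
  fixes S T :: "'a::ring set"
  assumes "max_pairwise_noncommuting S"
  shows "pairwise_noncommuting S" and "finite S" and "S \<noteq> {}"
    and "pairwise_noncommuting T \<Longrightarrow> card T \<le> card S"
  using assms by (auto simp: max_pairwise_noncommuting_def pairwise_noncommuting_def)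

lemma commutative_if_card_1:
  fixes S :: "'a::ring set" and x :: 'a
  assumes "max_pairwise_noncommuting S" and "card S = 1"
  shows "centralizer x = UNIV"
proof (rule ccontr)
  assume "centralizer x \<noteq> UNIV"
  then obtain y where "x * y \<noteq> y * x"
    by (auto simp: centralizer_def)
  then have "x \<noteq> y" "pairwise_noncommuting {x, y}"
    by (auto simp: pairwise_noncommuting_def pairwise_def)
  then show False
    using max_pairwise_noncommutingD(4)[OF assms(1), of "{x, y}"] assms(2) by simp
qed

lemma noncentral_if_mem_pairwise_noncommuting:
  assumes "pairwise_noncommuting S" and "2 \<le> card S" and "r \<in> S"
  shows "centralizer r \<noteq> UNIV"
proof
  assume "centralizer r = UNIV"
  then have "S \<subseteq> {r}"
    using pairwise_noncommutingD[OF assms(1) assms(3)] by blast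
  then have "card S \<le> 1"
    using card_mono[of "{r}" S] by simp
  with assms(2) show False by simp
qed

lemma card_centralizers_of_pairwise_noncommuting:
  assumes "pairwise_noncommuting S" and "2 \<le> card S"
  shows "card (insert UNIV (centralizer ` S)) = card S + 1"
proof -
  have "inj_on centralizer S"
    using pairwise_noncommutingD[OF assms(1)] self_mem_centralizer
    by (metis inj_onI)
  moreover have "UNIV \<notin> centralizer ` S"
    using noncentral_if_mem_pairwise_noncommuting[OF assms] by auto
  moreover have "finite S"
    using assms(1) by (simp add: pairwise_noncommuting_def)
  ultimately show ?thesis
    by (simp add: card_image)
qed

lemma centralizers_subset_Cent: "insert UNIV (centralizer ` S) \<subseteq> Cent"
  unfolding Cent_def using centralizer_zero by (metis image_mono insert_subset rangeI subset_UNIV)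

text \<open>
  The commutator of \<open>w\<close> with \<open>v + x\<close> is the sum of those with \<open>v\<close> and with \<open>x\<close>, and the latter is
  nonzero, so at most one of \<open>v\<close> and \<open>v + x\<close> commutes with \<open>w\<close>.
\<close>

lemma obtain_shift_not_commuting:
  assumes "v \<in> centralizer x" and "x \<notin> centralizer w"
  obtains v' where "v' \<in> {v, v + x}" "v' \<in> centralizer x" "v' \<notin> centralizer w"
  using assms add_mem_centralizer_iff(1)[of v w x] add_mem_centralizer_iff(2)[of x x v]
    self_mem_centralizer[of x] by blast

lemma five_pairwise_noncommuting:
  fixes x :: "'a::ring"
  assumes "centralizer x \<noteq> UNIV"
    and "y \<in> centralizer x" "z \<in> centralizer x" "z \<notin> centralizer y"
  shows "\<exists>T :: 'a set. pairwise_noncommuting T \<and> card T = 5"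
proof -
  obtain w where "w \<notin> centralizer x"
    using assms(1) by blast
  then have wx: "x \<notin> centralizer w"
    by (simp add: mem_centralizer_commute[of x w])
  obtain a where a: "a \<in> {y, y + x}" "a \<in> centralizer x" "a \<notin> centralizer w"
    using obtain_shift_not_commuting[OF assms(2) wx] .
  obtain b where b: "b \<in> {z, z + x}" "b \<in> centralizer x" "b \<notin> centralizer w"
    using obtain_shift_not_commuting[OF assms(3) wx] .
  have "a + b \<in> centralizer x"
    using a(2) b(2) by (simp add: add_mem_centralizer_iff)
  then obtain c where c: "c \<in> {a + b, a + b + x}" "c \<in> centralizer x" "c \<notin> centralizer w"
    using obtain_shift_not_commuting[OF _ wx] by blast
  have xa: "x * a = a * x" and xb: "x * b = b * x" and xc: "x * c = c * x"
    using a(2) b(2) c(2) by (simp_all add: centralizer_def)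
  have ab: "a * b \<noteq> b * a"
    using assms(2-4) a(1) b(1) by (auto simp: centralizer_def algebra_simps)
  have ac: "a * c \<noteq> c * a"
    using ab c(1) xa by (auto simp: algebra_simps)
  have bc: "b * c \<noteq> c * b"
    using ab c(1) xb by (auto simp: algebra_simps)
  have w: "w * a \<noteq> a * w" "w * b \<noteq> b * w" "w * c \<noteq> c * w" "w * x \<noteq> x * w"
    using a(3) b(3) c(3) wx by (simp_all add: centralizer_def)
  have wx': "(w + x) * a \<noteq> a * (w + x)" "(w + x) * b \<noteq> b * (w + x)"
    "(w + x) * c \<noteq> c * (w + x)" "(w + x) * w \<noteq> w * (w + x)"
    using w xa xb xc by (auto simp: distrib_left distrib_right)
  let ?T = "{a, b, c, w, w + x}"
  have "pairwise_noncommuting ?T"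
    unfolding pairwise_noncommuting_def pairwise_insert
    using ab ac bc w(1-3) wx' by (auto dest: not_sym)
  moreover have "distinct [a, b, c, w, w + x]"
    using ab ac bc w wx' by auto
  then have "card ?T = 5"
    using distinct_card[of "[a, b, c, w, w + x]"] by simp
  ultimately show ?thesis by blast
qed

text \<open>
  By \<open>five_pairwise_noncommuting\<close> non-central elements have commutative centralizers here. So each
  of two commuting non-central elements has its centralizer contained in the other's.
\<close>

lemma centralizer_eq_if_commute:
  fixes S :: "'a::ring set" and x y :: 'a
  assumes "max_pairwise_noncommuting S" and "card S \<le> 4"
    and "centralizer x \<noteq> UNIV" "centralizer y \<noteq> UNIV" "y \<in> centralizer x"
  shows "centralizer x = centralizer y"
proof -
  have le: "centralizer u \<subseteq> centralizer v"
    if uv: "centralizer u \<noteq> UNIV" "v \<in> centralizer u" for u v :: 'a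
  proof (rule subsetI, rule ccontr)
    fix z assume "z \<in> centralizer u" "z \<notin> centralizer v"
    then obtain T :: "'a set" where "pairwise_noncommuting T" "card T = 5"
      using five_pairwise_noncommuting[OF uv] by blast
    then show False
      using max_pairwise_noncommutingD(4)[OF assms(1)] assms(2) by fastforce
  qed
  show ?thesis
    using le[of x y] le[of y x] assms(3-5) mem_centralizer_commute[of y x] by blast
qed

lemma ex_commuting_in_max_pairwise_noncommuting:
  assumes "max_pairwise_noncommuting S"
  shows "\<exists>r\<in>S. r \<in> centralizer x"
proof (rule ccontr)
  assume *: "\<not> (\<exists>r\<in>S. r \<in> centralizer x)"
  then have "x \<notin> S"
    using self_mem_centralizer by blast
  moreover have "pairwise_noncommuting (insert x S)"
    using * max_pairwise_noncommutingD(1)[OF assms]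
    by (auto simp: pairwise_noncommuting_def pairwise_insert centralizer_def)
  ultimately show False
    using max_pairwise_noncommutingD(2,4)[OF assms] by fastforce
qed

lemma Cent_eq_if_card_le_4:
  assumes "max_pairwise_noncommuting S" and "2 \<le> card S" "card S \<le> 4"
  shows "Cent = insert UNIV (centralizer ` S)"
proof
  show "Cent \<subseteq> insert UNIV (centralizer ` S)"
  proof
    fix C assume "C \<in> (Cent :: 'a set set)"
    then obtain x where x: "C = centralizer x"
      by (auto simp: Cent_def)
    obtain r where r: "r \<in> S" "r \<in> centralizer x"
      using ex_commuting_in_max_pairwise_noncommuting[OF assms(1)] by blast
    have "centralizer r \<noteq> UNIV"
      using noncentral_if_mem_pairwise_noncommuting max_pairwise_noncommutingD(1) assms(1,2) r(1)
      by blast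
    then have "centralizer x = UNIV \<or> centralizer x = centralizer r"
      using centralizer_eq_if_commute[OF assms(1,3)] r(2) by blast
    then show "C \<in> insert UNIV (centralizer ` S)"
      using x r(1) by auto
  qed
qed (rule centralizers_subset_Cent)

theorem theorem2p8:
  fixes S :: "'a::{finite, ring} set" and t :: nat
  assumes "max_pairwise_noncommuting S" and "card S = t"
  shows "(card (Cent :: 'a set set) = 4 \<longleftrightarrow> t = 3) \<and>
         (card (Cent :: 'a set set) = 5 \<longleftrightarrow> t = 4)"
proof -
  note S = max_pairwise_noncommutingD[OF assms(1)]
  have "t \<noteq> 0"
    using S(2,3) assms(2) by auto
  then consider "t = 1" | "2 \<le> t"
    by linarith
  then show ?thesis
  proof cases
    case 1
    then have Cent: "(Cent :: 'a set set) = {UNIV}"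
      using commutative_if_card_1[OF assms(1)] assms(2) by (auto simp: Cent_def)
    show ?thesis
      unfolding Cent using 1 by simp
  next
    case 2
    have "t + 1 \<le> card (Cent :: 'a set set)"
      using card_mono[OF finite centralizers_subset_Cent[of S]]
        card_centralizers_of_pairwise_noncommuting[OF S(1)] assms(2) 2 by simp
    moreover have "card (Cent :: 'a set set) = t + 1" if "t \<le> 4"
      using Cent_eq_if_card_le_4[OF assms(1)] that 2 assms(2)
        card_centralizers_of_pairwise_noncommuting[OF S(1)] by simp
    ultimately show ?thesis by linarith
  qed
qed

end
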